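(* The Average-Impact (AI) value $\lambda$ is the only measure of average impact in $\Theta$ that satisfies all of the properties $P_{11}$ (Symmetric-Impact), $P_{12}$ (Average-Value) and $P_{13}$ (Marginal-Impact). That is, $\lambda$ satisfies $P_{11},P_{12},P_{13}$, and if $\theta\in\Theta$ satisfies $P_{11},P_{12},P_{13}$ then $\theta=\lambda$, i.e. $\theta^N_v(i)=\lambda^N_v(i)$ for every game $(N,v)\in\mathscr{G}$ and every $i\in N$.
   Context: Fix a universe of players $\mathscr{N}$. A (characteristic-function) game is a pair $(N,v)$, where $N\subseteq\mathscr{N}$ is a finite nonempty set of players, $n=|N|$, and $v:2^N\to\mathbb{R}$ satisfies $v(\emptyset)=0$. Subsets of $N$ are called coalitions. $\mathscr{G}$ is the set of all games. For $C\subseteq N$, the sub-game $(C,v)$ is the game with player set $C$ and $v$ restricted to $2^C$. In a game $(N,v)$, players $i,j\in N$ are symmetric if $v(C\cup\{i\})=v(C\cup\{j\})$ for every $C\subseteq N\setminus\{i,j\}$. The marginal contribution of $i\in N$ to $C\subseteq N$ is $\mathit{MC}^C_i(N,v)=v(C\cup\{i\})-v(C)$. The Shapley value of $i\in N$ in $(N,v)$ is $$\phi_i(N,v)=\sum_{C\subseteq N\setminus\{i\}}\frac{|C|!\,(n-|C|-1)!}{n!}\big(v(C\cup\{i\})-v(C)\big).$$ For a sub-game $(C,v)$, $\phi_i(C,v)$ is given by the same formula with $N$ replaced by $C$ and $n$ by $|C|$. A measure of average impact is a function $\theta$ assigning a real number $\theta^N_v(i)$ to each game $(N,v)\in\mathscr{G}$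 and player $i\in N$. $\Theta$ is the set of all such measures. The Average-Impact (AI) value $\lambda\in\Theta$ is $$\lambda^N_v(i)=\overline{\phi}_i(N,v)=2^{1-n}\sum_{C\subseteq N:\,i\in C}\phi_i(C,v).$$ Properties of $\theta\in\Theta$: - $P_{11}$: for every game $(N,v)\in\mathscr{G}$ and every pair of symmetric players $i,j$ in it, $\theta^N_v(i)=\theta^N_v(j)$. - $P_{12}$: for every game $(N,v)\in\mathscr{G}$, $\frac12\sum_{i\in N}\theta^N_v(i)=2^{-n}\sum_{C\subseteq N}v(C)$. - $P_{13}$: for every pair of games $(N,v),(N,w)$ with the same player set and every $i\in N$, if $\mathit{MC}^C_i(N,v)=\mathit{MC}^C_i(N,w)$ for all $C\subseteq N\setminus\{i\}$, then $\theta^N_v(i)=\theta^N_w(i)$. *)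

theory Defs
  imports Complex_Main "HOL-Library.FuncSet"
begin

text \<open>
  The universe of players is the type \<^typ>\<open>'p\<close>. A characteristic function on \<^term>\<open>N\<close> is
  a function on \<^term>\<open>Pow N\<close>, represented by the total function that is \<^term>\<open>undefined\<close>
  elsewhere. Hence a game is determined by its values on coalitions only, and a measure
  cannot depend on values outside \<^term>\<open>Pow N\<close>.
\<close>

type_synonym 'p game = "'p set \<times> ('p set \<Rightarrow> real)"

definition games :: "'p game set" where
  "games = {(N, v). finite N \<and> N \<noteq> {} \<and> v \<in> extensional (Pow N) \<and> v {} = 0}"

definition sub_game :: "'p game \<Rightarrow> 'p set \<Rightarrow> 'p game" where
  "sub_game = (\<lambda>(N, v) C. (C, restrict v (Pow C)))"

definition symmetric_players :: "'p game \<Rightarrow> 'p \<Rightarrow> 'p \<Rightarrow> bool" where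
  "symmetric_players = (\<lambda>(N, v) i j. i \<in> N \<and> j \<in> N \<and>
     (\<forall>C. C \<subseteq> N - {i, j} \<longrightarrow> v (C \<union> {i}) = v (C \<union> {j})))"

definition marginal_contribution :: "'p game \<Rightarrow> 'p set \<Rightarrow> 'p \<Rightarrow> real" where
  "marginal_contribution = (\<lambda>(N, v) C i. v (C \<union> {i}) - v C)"

text \<open>For \<^term>\<open>i \<in> N\<close> the natural-number subtraction below never truncates.\<close>

definition shapley :: "'p game \<Rightarrow> 'p \<Rightarrow> real" where
  "shapley = (\<lambda>(N, v) i. \<Sum>C | C \<subseteq> N - {i}.
     fact (card C) * fact (card N - card C - 1) / fact (card N) * (v (C \<union> {i}) - v C))"

text \<open>
  Only the values of a measure at a game \<^term>\<open>G \<in> games\<close> and a player of \<^term>\<open>G\<close> are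
  meaningful; two measures are the same if they agree at all of these.
\<close>

type_synonym 'p impact_measure = "'p game \<Rightarrow> 'p \<Rightarrow> real"

definition AI_value :: "'p impact_measure" where
  "AI_value = (\<lambda>(N, v) i.
     2 powi (1 - int (card N)) * (\<Sum>C | C \<subseteq> N \<and> i \<in> C. shapley (sub_game (N, v) C) i))"

definition symmetric_impact :: "'p impact_measure \<Rightarrow> bool" where
  "symmetric_impact \<theta> \<longleftrightarrow>
     (\<forall>N v i j. (N, v) \<in> games \<and> symmetric_players (N, v) i j \<longrightarrow> \<theta> (N, v) i = \<theta> (N, v) j)"

definition average_value :: "'p impact_measure \<Rightarrow> bool" where
  "average_value \<theta> \<longleftrightarrow>
     (\<forall>N v. (N, v) \<in> games \<longrightarrow>
        1 / 2 * (\<Sum>i\<in>N. \<theta> (N, v) i) = 2 powi (- int (card N)) * (\<Sum>C\<in>Pow N. v C))"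

definition marginal_impact :: "'p impact_measure \<Rightarrow> bool" where
  "marginal_impact \<theta> \<longleftrightarrow>
     (\<forall>N v w. (N, v) \<in> games \<and> (N, w) \<in> games \<longrightarrow>
        (\<forall>i\<in>N. (\<forall>C. C \<subseteq> N - {i} \<longrightarrow>
                  marginal_contribution (N, v) C i = marginal_contribution (N, w) C i)
               \<longrightarrow> \<theta> (N, v) i = \<theta> (N, w) i))"

end

theory Submission
  imports Defs "HOL-Combinatorics.Transposition"
begin

text \<open>
  Existence rests on the efficiency of the Shapley value, summed over all sub-games. Uniqueness
  is Young's argument: write \<^term>\<open>v\<close> as a combination of unanimity games and induct on the
  number of nonzero coefficients. A player missing from the carrier of some term keeps its
  marginal contributions when that term is dropped, so the marginal-impact property applies;
  the players common to all carriers are pairwise symmetric, so the average-value property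
  determines their common impact.
\<close>

section \<open>Sub-games and efficiency of the Shapley value\<close>

lemma shapley_sub_game:
  assumes "i \<in> C"
  shows "shapley (sub_game (N, v) C) i = shapley (C, v) i"
proof -
  have "restrict v (Pow C) (S \<union> {i}) = v (S \<union> {i}) \<and> restrict v (Pow C) S = v S"
    if "S \<subseteq> C - {i}" for S
    using assms that by auto
  then show ?thesis
    unfolding shapley_def sub_game_def by (auto intro!: sum.cong)
qed

lemma AI_value_eq:
  "AI_value (N, v) i = 2 powi (1 - int (card N)) * (\<Sum>C | C \<subseteq> N \<and> i \<in> C. shapley (C, v) i)"
  unfolding AI_value_def by (simp add: shapley_sub_game)

text \<open>Efficiency, by collecting the coefficient of each \<open>v T\<close>: members of
  \<open>T\<close> contribute positively, the other players of \<open>C\<close> negatively. The two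
  parts cancel except at \<open>T = C\<close>, which has no outsiders, and at \<open>T = {}\<close>,
  which has no members.\<close>

lemma sum_shapley:
  assumes "finite C" "C \<noteq> {}"
  shows "(\<Sum>i\<in>C. shapley (C, v) i) = v C - v {}"
proof -
  define n where "n = card C"
  have n: "n > 0" using assms by (simp add: n_def card_gt_0_iff)
  define c :: "nat \<Rightarrow> real" where "c s = fact s * fact (n - s - 1) / fact n" for s
  \<comment> \<open>Reindexing by \<open>T = insert i S\<close> and exchanging the sums counts each
    \<open>T\<close> once per member.\<close>
  have "(\<Sum>i\<in>C. \<Sum>S | S \<subseteq> C - {i}. c (card S) * v (S \<union> {i}))
      = (\<Sum>i\<in>C. \<Sum>T | T \<subseteq> C \<and> i \<in> T. c (card T - 1) * v T)"
  proof (rule sum.cong[OF refl])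
    fix i assume i: "i \<in> C"
    have "card S = card (insert i S) - 1" if "S \<subseteq> C - {i}" for S
      using that assms finite_subset[of S C] by (subst card_insert_disjoint) auto
    with i show "(\<Sum>S | S \<subseteq> C - {i}. c (card S) * v (S \<union> {i}))
        = (\<Sum>T | T \<subseteq> C \<and> i \<in> T. c (card T - 1) * v T)"
      by (intro sum.reindex_bij_witness[of _ "\<lambda>T. T - {i}" "insert i"])
        (auto simp: insert_absorb)
  qed
  also have "\<dots> = (\<Sum>T\<in>Pow C. \<Sum>i | i \<in> C \<and> i \<in> T. c (card T - 1) * v T)"
    using sum.swap_restrict[of C "Pow C" "\<lambda>i T. c (card T - 1) * v T" "\<lambda>i T. i \<in> T"] assms
    by simp
  also have "\<dots> = (\<Sum>T\<in>Pow C. card T * c (card T - 1) * v T)"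
  proof (rule sum.cong[OF refl])
    fix T assume "T \<in> Pow C"
    then have "{i. i \<in> C \<and> i \<in> T} = T" by auto
    then show "(\<Sum>i | i \<in> C \<and> i \<in> T. c (card T - 1) * v T) = card T * c (card T - 1) * v T"
      by simp
  qed
  finally have gain: "(\<Sum>i\<in>C. \<Sum>S | S \<subseteq> C - {i}. c (card S) * v (S \<union> {i}))
      = (\<Sum>T\<in>Pow C. card T * c (card T - 1) * v T)" .
  have "(\<Sum>i\<in>C. \<Sum>S | S \<subseteq> C - {i}. c (card S) * v S)
      = (\<Sum>i\<in>C. \<Sum>S | S \<in> Pow C \<and> i \<notin> S. c (card S) * v S)"
    by (intro sum.cong) auto
  also have "\<dots> = (\<Sum>S\<in>Pow C. \<Sum>i | i \<in> C \<and> i \<notin> S. c (card S) * v S)"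
    using sum.swap_restrict[of C "Pow C" "\<lambda>i S. c (card S) * v S" "\<lambda>i S. i \<notin> S"] assms
    by simp
  also have "\<dots> = (\<Sum>S\<in>Pow C. real (n - card S) * c (card S) * v S)"
  proof (rule sum.cong[OF refl])
    fix S assume "S \<in> Pow C"
    then have "card {i. i \<in> C \<and> i \<notin> S} = n - card S"
      using assms by (simp add: n_def card_Diff_subset finite_subset flip: set_diff_eq)
    then show "(\<Sum>i | i \<in> C \<and> i \<notin> S. c (card S) * v S) = real (n - card S) * c (card S) * v S"
      by simp
  qed
  finally have loss: "(\<Sum>i\<in>C. \<Sum>S | S \<subseteq> C - {i}. c (card S) * v S)
      = (\<Sum>S\<in>Pow C. real (n - card S) * c (card S) * v S)" .
  \<comment> \<open>Both products equal \<open>fact t * fact (n - t) / fact n\<close>, except that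
    the first vanishes at \<open>t = 0\<close> and the second at \<open>t = n\<close>. Exactly there
    the subtraction inside \<open>c\<close> or its argument truncates, and the factor 0 hides
    it.\<close>
  have coeff: "real t * c (t - 1) - real (n - t) * c t
      = (if t = n then 1 else 0) - (if t = 0 then 1 else 0)" if t: "t \<le> n" for t
  proof -
    have left: "real t * c (t - 1) = (if t = 0 then 0 else fact t * fact (n - t) / fact n)"
      by (cases t) (auto simp: c_def algebra_simps)
    have right: "real (n - t) * c t = (if t = n then 0 else fact t * fact (n - t) / fact n)"
      using t by (cases "n - t") (auto simp: c_def algebra_simps)
    show ?thesis using left right n by auto
  qed
  have "(\<Sum>i\<in>C. shapley (C, v) i)
      = (\<Sum>T\<in>Pow C. (real (card T) * c (card T - 1) - real (n - card T) * c (card T)) * v T)"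
    using gain loss
    by (simp add: shapley_def c_def n_def right_diff_distrib left_diff_distrib sum_subtractf)
  also have "\<dots> = (\<Sum>T\<in>Pow C. (if T = C then v T else 0) - (if T = {} then v T else 0))"
  proof (rule sum.cong[OF refl])
    fix T assume "T \<in> Pow C"
    then have T: "T \<subseteq> C" "finite T" using assms finite_subset by auto
    then have "card T \<le> n" "card T = n \<longleftrightarrow> T = C" "card T = 0 \<longleftrightarrow> T = {}"
      using assms card_subset_eq[OF assms(1) T(1)] by (auto simp: n_def card_mono)
    then have "real (card T) * c (card T - 1) - real (n - card T) * c (card T)
        = (if T = C then 1 else 0) - (if T = {} then 1 else 0)"
      by (simp only: coeff)
    then show "(real (card T) * c (card T - 1) - real (n - card T) * c (card T)) * v T
        = (if T = C then v T else 0) - (if T = {} then v T else 0)"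
      by (simp only:) simp
  qed
  also have "\<dots> = v C - v {}"
    using assms by (simp add: sum_subtractf)
  finally show ?thesis .
qed

section \<open>The three properties of the average-impact value\<close>

text \<open>Exchanging the sums over players and coalitions leaves the total Shapley value of each
  sub-game, which is \<open>v C\<close> by efficiency.\<close>

lemma average_value_AI_value: "average_value AI_value"
  unfolding average_value_def
proof (intro allI impI)
  fix N :: "'a set" and v assume "(N, v) \<in> games"
  then have N: "finite N" "v {} = 0" by (auto simp: games_def)
  have "(\<Sum>i\<in>N. \<Sum>C | C \<subseteq> N \<and> i \<in> C. shapley (C, v) i)
      = (\<Sum>C\<in>Pow N. \<Sum>i | i \<in> N \<and> i \<in> C. shapley (C, v) i)"
    using sum.swap_restrict[of N "Pow N" "\<lambda>i C. shapley (C, v) i" "\<lambda>i C. i \<in> C"] N by simp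
  also have "\<dots> = (\<Sum>C\<in>Pow N. v C)"
  proof (rule sum.cong[OF refl])
    fix C assume C: "C \<in> Pow N"
    then have "{i. i \<in> N \<and> i \<in> C} = C" by auto
    then show "(\<Sum>i | i \<in> N \<and> i \<in> C. shapley (C, v) i) = v C"
      \<comment> \<open>Efficiency covers nonempty \<open>C\<close>; for \<open>C = {}\<close> the
        empty sum equals \<open>v {} = 0\<close>.\<close>
      using C N finite_subset[of C N] by (cases "C = {}") (auto simp: sum_shapley)
  qed
  finally have "(\<Sum>i\<in>N. AI_value (N, v) i) = 2 powi (1 - int (card N)) * (\<Sum>C\<in>Pow N. v C)"
    by (simp add: AI_value_eq flip: sum_distrib_left)
  then show "1 / 2 * (\<Sum>i\<in>N. AI_value (N, v) i) = 2 powi (- int (card N)) * (\<Sum>C\<in>Pow N. v C)"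
    by (simp add: power_int_diff power_int_minus field_simps)
qed

text \<open>The Shapley value of \<open>i\<close> in any sub-game is a weighted sum of marginal
  contributions of \<open>i\<close> to subsets of \<open>N - {i}\<close>.\<close>

lemma marginal_impact_AI_value: "marginal_impact AI_value"
  unfolding marginal_impact_def
proof (intro allI impI ballI)
  fix N :: "'a set" and v w i
  assume "\<forall>C. C \<subseteq> N - {i} \<longrightarrow>
    marginal_contribution (N, v) C i = marginal_contribution (N, w) C i"
  then have "v (C \<union> {i}) - v C = w (C \<union> {i}) - w C" if "C \<subseteq> N - {i}" for C
    using that by (simp add: marginal_contribution_def)
  then have "shapley (C, v) i = shapley (C, w) i" if "C \<subseteq> N" for C
    unfolding shapley_def prod.case using that
    by (intro sum.cong refl) (metis Diff_mono mem_Collect_eq order_refl subset_trans)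
  then show "AI_value (N, v) i = AI_value (N, w) i"
    by (simp add: AI_value_eq)
qed

text \<open>Turns symmetry of two players into invariance of \<open>v\<close> under swapping them. A
  set containing both or neither is fixed; otherwise symmetry is applied to the set without the
  player it contains.\<close>

lemma symmetric_players_transpose:
  assumes "symmetric_players (N, v) i j" "S \<subseteq> N"
  shows "v (transpose i j ` S) = v S"
proof -
  have swap: "v (insert i C) = v (insert j C)" if "C \<subseteq> N - {i, j}" for C
    using assms that by (simp add: symmetric_players_def)
  consider "i \<in> S \<longleftrightarrow> j \<in> S" | "i \<in> S" "j \<notin> S" | "i \<notin> S" "j \<in> S" by blast
  then show ?thesis
  proof cases
    case 1
    then show ?thesis by simp
  next
    case 2
    then have "transpose i j ` S = insert j (S - {i})" "S = insert i (S - {i})"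
      by (auto simp: transpose_def image_iff)
    then show ?thesis using swap[of "S - {i}"] 2 assms by force
  next
    case 3
    then have "transpose i j ` S = insert i (S - {j})" "S = insert j (S - {j})"
      by (auto simp: transpose_def image_iff)
    then show ?thesis using swap[of "S - {j}"] 3 assms by force
  qed
qed

text \<open>Relabelling by the swap preserves cardinalities and matches the subsets of
  \<open>C - {i}\<close> with those of the image of \<open>C\<close> without \<open>j\<close>. The
  player \<open>j\<close> may lie outside \<open>C\<close>, in which case the coalition itself
  changes.\<close>

lemma shapley_transpose:
  assumes "\<And>S. S \<subseteq> C \<Longrightarrow> v (transpose i j ` S) = v S" "i \<in> C"
  shows "shapley (C, v) i = shapley (transpose i j ` C, v) j"
proof -
  note card = card_image[OF inj_on_transpose]
  have "v (insert j (transpose i j ` S)) = v (insert i S)" if "S \<subseteq> C - {i}" for S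
    using assms(1)[of "insert i S"] that assms(2) by auto
  moreover have "v (transpose i j ` S) = v S" if "S \<subseteq> C - {i}" for S
    using assms(1)[of S] that by auto
  moreover have "transpose i j ` S \<subseteq> transpose i j ` C - {j}" if "S \<subseteq> C - {i}" for S
    using that by (auto simp: transpose_eq_iff)
  moreover have "transpose i j ` S \<subseteq> C - {i}" if "S \<subseteq> transpose i j ` C - {j}" for S
    using that by (auto simp: transpose_eq_iff)
  ultimately show ?thesis
    unfolding shapley_def prod.case
    by (intro sum.reindex_bij_witness[of _ "image (transpose i j)" "image (transpose i j)"])
      (auto simp: image_image card)
qed

text \<open>The swap is a bijection between the coalitions containing \<open>i\<close> and those
  containing \<open>j\<close>, and it preserves the Shapley terms.\<close>

lemma symmetric_impact_AI_value: "symmetric_impact AI_value"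
  unfolding symmetric_impact_def
proof (intro allI impI)
  fix N :: "'a set" and v i j
  assume "(N, v) \<in> games \<and> symmetric_players (N, v) i j"
  then have sym: "symmetric_players (N, v) i j" by simp
  then have ij: "i \<in> N" "j \<in> N" by (auto simp: symmetric_players_def)
  have *: "transpose i j ` C \<subseteq> N" if "C \<subseteq> N" for C
    using that ij by (auto simp: transpose_def)
  have "(\<Sum>C | C \<subseteq> N \<and> i \<in> C. shapley (C, v) i) = (\<Sum>C | C \<subseteq> N \<and> j \<in> C. shapley (C, v) j)"
  proof (rule sum.reindex_bij_witness[of _ "image (transpose i j)" "image (transpose i j)"])
    fix C assume C: "C \<in> {C. C \<subseteq> N \<and> i \<in> C}"
    show "shapley (transpose i j ` C, v) j = shapley (C, v) i"
      using C by (intro shapley_transpose[symmetric] symmetric_players_transpose[OF sym]) auto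
  qed (use * in \<open>force simp: image_image\<close>)+
  then show "AI_value (N, v) i = AI_value (N, v) j"
    by (simp add: AI_value_eq)
qed

section \<open>Harsanyi dividends and uniqueness\<close>

text \<open>
  The game with Harsanyi dividends \<^term>\<open>d\<close>. The empty set is excluded so that the result is
  a game for every \<^term>\<open>d\<close>.
\<close>

definition dividend_game :: "'p set \<Rightarrow> ('p set \<Rightarrow> real) \<Rightarrow> 'p set \<Rightarrow> real" where
  "dividend_game N d = (\<lambda>C\<in>Pow N. \<Sum>T\<in>Pow C - {{}}. d T)"

lemma dividend_game_in_games:
  assumes "finite N" "N \<noteq> {}"
  shows "(N, dividend_game N d) \<in> games"
  using assms by (auto simp: games_def dividend_game_def)

text \<open>Moebius inversion over the subset lattice; \<open>v {} = 0\<close> makes the dividend of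
  the empty set vanish.\<close>

lemma games_dividendE:
  assumes "(N, v) \<in> games"
  obtains d where "v = dividend_game N d"
proof
  have v: "finite N" "v \<in> extensional (Pow N)" "v {} = 0"
    using assms by (auto simp: games_def)
  \<comment> \<open>With the sign \<open>(-1) ^ card T\<close> the transform is its own inverse, so
    the dividend of \<open>T\<close> is \<open>g T\<close> up to that sign.\<close>
  define g where "g S = (\<Sum>T\<in>Pow S. (-1) ^ card T * v T)" for S
  have "v S = (\<Sum>T\<in>Pow S. (-1) ^ card T * g T)" if "finite S" for S
    using inclusion_exclusion_symmetric[of g v S] that by (simp add: g_def)
  moreover have "g {} = 0" by (simp add: g_def v)
  ultimately have "v S = (\<Sum>T\<in>Pow S - {{}}. (-1) ^ card T * g T)" if "finite S" for S
    using that by (simp add: sum.remove[of "Pow S" "{}"])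
  then show "v = dividend_game N (\<lambda>T. (-1) ^ card T * g T)"
    using v by (intro extensionalityI[of _ "Pow N"])
      (auto simp: dividend_game_def intro: finite_subset)
qed

text \<open>Comparing two arbitrary measures lets \<open>AI_value\<close> enter only as an instance.
  There is no separate base case: if no carrier is left, then \<open>R = N\<close> and all players
  are symmetric.\<close>

lemma impact_measure_unique:
  assumes \<theta>: "symmetric_impact \<theta>" "average_value \<theta>" "marginal_impact \<theta>"
    and \<eta>: "symmetric_impact \<eta>" "average_value \<eta>" "marginal_impact \<eta>"
    and N: "finite N" "N \<noteq> {}" and "i \<in> N"
  shows "\<theta> (N, dividend_game N d) i = \<eta> (N, dividend_game N d) i"
  using \<open>i \<in> N\<close>
proof (induction "card {T. T \<subseteq> N \<and> d T \<noteq> 0}" arbitrary: d i rule: less_induct)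
  case less
  let ?v = "dividend_game N d"
  \<comment> \<open>\<open>D\<close> omits the empty set because \<open>d {}\<close> does not enter
    the game.\<close>
  define D where "D = {T. T \<subseteq> N \<and> T \<noteq> {} \<and> d T \<noteq> 0}"
  define R where "R = {i \<in> N. \<forall>T\<in>D. i \<in> T}"
  have v: "(N, ?v) \<in> games" using N by (rule dividend_game_in_games)
  have outside: "\<theta> (N, ?v) k = \<eta> (N, ?v) k" if k: "k \<in> N - R" for k
  proof -
    \<comment> \<open>All carriers missing \<open>k\<close> are dropped at once.\<close>
    define e where "e T = (if k \<in> T then d T else 0)" for T
    let ?w = "dividend_game N e"
    have w: "(N, ?w) \<in> games" using N by (rule dividend_game_in_games)
    have marg: "marginal_contribution (N, ?v) C k = marginal_contribution (N, ?w) C k"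
      if C: "C \<subseteq> N - {k}" for C
    proof -
      have "finite C" using C N finite_subset by auto
      then have fin: "finite (Pow (insert k C) - {{}})" by simp
      have sub: "Pow C - {{}} \<subseteq> Pow (insert k C) - {{}}" by auto
      \<comment> \<open>Subsets of \<open>C\<close> cancel, leaving exactly the carriers that
        contain \<open>k\<close>, where \<open>d\<close> and \<open>e\<close> agree.\<close>
      have *: "dividend_game N f (C \<union> {k}) - dividend_game N f C
          = sum f (Pow (insert k C) - {{}} - (Pow C - {{}}))" for f
        using C k sum_diff[OF fin sub, of f] by (auto simp: dividend_game_def)
      show ?thesis unfolding marginal_contribution_def prod.case *
        by (intro sum.cong) (auto simp: e_def)
    qed
    obtain T where "T \<subseteq> N" "d T \<noteq> 0" "k \<notin> T" using k by (auto simp: R_def D_def)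
    then have "{T. T \<subseteq> N \<and> e T \<noteq> 0} \<subset> {T. T \<subseteq> N \<and> d T \<noteq> 0}"
      by (auto simp: e_def)
    then have "card {T. T \<subseteq> N \<and> e T \<noteq> 0} < card {T. T \<subseteq> N \<and> d T \<noteq> 0}"
      using N by (intro psubset_card_mono) auto
    then have "\<theta> (N, ?w) k = \<eta> (N, ?w) k"
      using less.hyps k by simp
    moreover have "\<theta> (N, ?v) k = \<theta> (N, ?w) k" "\<eta> (N, ?v) k = \<eta> (N, ?w) k"
      using \<theta>(3) \<eta>(3) v w marg k unfolding marginal_impact_def by blast+
    ultimately show ?thesis by simp
  qed
  show ?case
  proof (cases "i \<in> R")
    case False
    then show ?thesis using outside less.prems by simp
  next
    case True
    have sym: "symmetric_players (N, ?v) i j" if j: "j \<in> R" for j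
    proof (cases "i = j")
      case True
      then show ?thesis using less.prems by (simp add: symmetric_players_def)
    next
      case False
      have "j \<in> N" using j by (simp add: R_def)
      \<comment> \<open>Every carrier in \<open>D\<close> contains both \<open>i\<close> and
        \<open>j\<close>, so none fits into \<open>S\<close>. This applies to
        \<open>C \<union> {i}\<close>, which misses \<open>j\<close>, and to
        \<open>C \<union> {j}\<close>, which misses \<open>i\<close>.\<close>
      have zero: "?v S = 0" if "S \<subseteq> N" "i \<notin> S \<or> j \<notin> S" for S
      proof -
        have "T \<notin> D" if "T \<subseteq> S" for T
          using that \<open>i \<notin> S \<or> j \<notin> S\<close> \<open>i \<in> R\<close> j unfolding R_def by blast
        then have "d T = 0" if "T \<in> Pow S - {{}}" for T
          using that \<open>S \<subseteq> N\<close> unfolding D_def by blast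
        then show ?thesis using that by (simp add: dividend_game_def)
      qed
      have "?v (C \<union> {i}) = 0" "?v (C \<union> {j}) = 0" if "C \<subseteq> N - {i, j}" for C
        using that \<open>j \<in> N\<close> less.prems False by (auto intro!: zero simp del: Un_insert_right)
      then show ?thesis
        using \<open>j \<in> N\<close> less.prems by (simp add: symmetric_players_def)
    qed
    have const: "\<theta> (N, ?v) j = \<theta> (N, ?v) i" "\<eta> (N, ?v) j = \<eta> (N, ?v) i" if "j \<in> R" for j
      using \<theta>(1) \<eta>(1) v sym[OF that] by (simp_all add: symmetric_impact_def)
    \<comment> \<open>The totals over \<open>N\<close> agree. Removing the players outside
      \<open>R\<close>, where the measures already agree, leaves \<open>card R\<close> equal
      summands on each side.\<close>
    have "(\<Sum>j\<in>N. \<theta> (N, ?v) j) = (\<Sum>j\<in>N. \<eta> (N, ?v) j)"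
      using \<theta>(2) \<eta>(2) v unfolding average_value_def by fastforce
    moreover have "R \<subseteq> N" by (auto simp: R_def)
    ultimately have "(\<Sum>j\<in>R. \<theta> (N, ?v) j) = (\<Sum>j\<in>R. \<eta> (N, ?v) j)"
      using N outside by (simp add: sum.subset_diff[of R N])
    then have "card R * \<theta> (N, ?v) i = card R * \<eta> (N, ?v) i"
      using const by simp
    moreover have "card R > 0"
      using True N \<open>R \<subseteq> N\<close> by (auto simp: card_gt_0_iff intro: finite_subset)
    ultimately show ?thesis by simp
  qed
qed

theorem theorem5p1:
  shows "(symmetric_impact (AI_value :: 'p impact_measure)
            \<and> average_value (AI_value :: 'p impact_measure)
            \<and> marginal_impact (AI_value :: 'p impact_measure))
       \<and> (\<forall>\<theta> :: 'p impact_measure.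
            symmetric_impact \<theta> \<and> average_value \<theta> \<and> marginal_impact \<theta> \<longrightarrow>
            (\<forall>N v. (N, v) \<in> games \<longrightarrow> (\<forall>i\<in>N. \<theta> (N, v) i = AI_value (N, v) i)))"
proof -
  note AI = symmetric_impact_AI_value average_value_AI_value marginal_impact_AI_value
  have "\<theta> (N, v) i = AI_value (N, v) i"
    if "symmetric_impact \<theta>" "average_value \<theta>" "marginal_impact \<theta>"
      and game: "(N, v) \<in> games" and "i \<in> N"
    for \<theta> :: "'p impact_measure" and N v i
  proof -
    from game obtain d where "v = dividend_game N d" by (rule games_dividendE)
    moreover have "finite N" "N \<noteq> {}" using game by (auto simp: games_def)
    ultimately show ?thesis using impact_measure_unique that AI by metis
  qed
  with AI show ?thesis by blast
qed

end
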